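(* For an integer $n\ge 10$ and $\delta>0$, let $M = M(\delta,n)$ be the $2\times2$ matrix defined in the context, and let $\rho(M)$ be its spectral radius. Then, as $\delta\to 0$, \[ \rho(M) = 1 - 2\delta - \frac{2\delta}{n} + 2\delta^2 + O\left(\frac{\delta^2}{n}\right) + O(\delta^3), \] that is, there exist constants $\delta_0\in(0,0.4]$ and $K>0$, independent of $n$ and $\delta$, such that for all $n\ge 10$ and all $\delta\in(0,\delta_0]$, \[ \left| \rho(M) - \left(1-2\delta-\frac{2\delta}{n}+2\delta^2\right)\right| \le K\left(\frac{\delta^2}{n}+\delta^3\right). \]
   Context: $\mathbf{1} = (1,1,\dots,1)^T \in \mathbb{R}^n$, $\|\cdot\|$ is the Euclidean norm, $\|\cdot\|_F$ the Frobenius norm. Let $A = \delta I + (1-\delta)\mathbf{1}\mathbf{1}^T\in\mathbb{R}^{n\times n}$, write $A = L + D + L^T$ with $L$ strictly lower triangular and $D=I$ the diagonal of $A$, and let $C = -(L+D)^{-1}L^T$. Define \[ d_2 = \frac{\|C\mathbf{1}\|^2 - \|C\|_F^2}{n(n-1)},\quad d_1 = \frac{\|C\|_F^2}{n} - d_2,\quad m_2 = \frac{(\mathbf{1}^TC\mathbf{1})^2 - \|C^T\mathbf{1}\|^2}{n(n-1)},\quad m_1 = \frac{\|C^T\mathbf{1}\|^2}{n} - m_2, \] \[ M = \begin{pmatrix} d_1 & m_1 \\ d_2 & m_2 \end{pmatrix}. \] *)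

theory Defs
  imports "Jordan_Normal_Form.Spectral_Radius" "Jordan_Normal_Form.Gauss_Jordan_Elimination"
begin

definition euclid_norm :: "real vec \<Rightarrow> real" where
  "euclid_norm v = sqrt (v \<bullet> v)"

definition frob_norm :: "real mat \<Rightarrow> real" where
  "frob_norm B = sqrt (\<Sum>i<dim_row B. \<Sum>j<dim_col B. (B $$ (i, j))\<^sup>2)"

definition ones :: "nat \<Rightarrow> real vec" where
  "ones n = vec n (\<lambda>_. 1)"

(* the outer product u v^T *)
definition outer :: "real vec \<Rightarrow> real vec \<Rightarrow> real mat" where
  "outer u v = mat (dim_vec u) (dim_vec v) (\<lambda>(i, j). u $ i * v $ j)"

definition strict_lower_part :: "real mat \<Rightarrow> real mat" where
  "strict_lower_part B = mat (dim_row B) (dim_col B) (\<lambda>(i, j). if j < i then B $$ (i, j) else 0)"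

definition diag_part :: "real mat \<Rightarrow> real mat" where
  "diag_part B = mat (dim_row B) (dim_col B) (\<lambda>(i, j). if i = j then B $$ (i, j) else 0)"

definition matA :: "real \<Rightarrow> nat \<Rightarrow> real mat" where
  "matA \<delta> n = \<delta> \<cdot>\<^sub>m 1\<^sub>m n + (1 - \<delta>) \<cdot>\<^sub>m outer (ones n) (ones n)"

definition matL :: "real \<Rightarrow> nat \<Rightarrow> real mat" where
  "matL \<delta> n = strict_lower_part (matA \<delta> n)"

definition matD :: "real \<Rightarrow> nat \<Rightarrow> real mat" where
  "matD \<delta> n = diag_part (matA \<delta> n)"

lemma matL_carrier: "matL \<delta> n \<in> carrier_mat n n"
  and matD_carrier: "matD \<delta> n \<in> carrier_mat n n"
  by (simp_all add: matL_def matD_def matA_def outer_def ones_def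
      strict_lower_part_def diag_part_def)

lemma matA_decomposition: "matA \<delta> n = matL \<delta> n + matD \<delta> n + transpose_mat (matL \<delta> n)"
  by (rule eq_matI)
    (auto simp: matL_def matD_def matA_def outer_def ones_def
      strict_lower_part_def diag_part_def)

lemma matD_eq_one: "matD \<delta> n = 1\<^sub>m n"
  by (rule eq_matI) (auto simp: matD_def matA_def outer_def ones_def diag_part_def)

(* mat_inverse is option-valued; the following lemma shows that the matrix inverted in matC
   is invertible, so that the application of the selector \<open>the\<close> is meaningful. *)
lemma mat_inverse_L_plus_D:
  obtains B where "mat_inverse (matL \<delta> n + matD \<delta> n) = Some B" "B \<in> carrier_mat n n"
    "(matL \<delta> n + matD \<delta> n) * B = 1\<^sub>m n" "B * (matL \<delta> n + matD \<delta> n) = 1\<^sub>m n"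
proof -
  let ?T = "matL \<delta> n + matD \<delta> n"
  have T: "?T \<in> carrier_mat n n"
    using matL_carrier matD_carrier by simp
  have "det ?T = prod_list (diag_mat ?T)"
    by (rule det_lower_triangular[OF _ T])
      (auto simp: matL_def matD_def matA_def outer_def ones_def
        strict_lower_part_def diag_part_def)
  also have "diag_mat ?T = map (\<lambda>_. 1) [0..<n]"
    by (auto simp: diag_mat_def matL_def matD_def matA_def outer_def ones_def
        strict_lower_part_def diag_part_def)
  also have "prod_list (map (\<lambda>_. 1) [0..<n]) = (1 :: real)"
    by (induction n) auto
  finally have "?T \<in> Units (ring_mat TYPE(real) n ())"
    using det_non_zero_imp_unit[OF T] by simp
  then obtain B where B: "mat_inverse ?T = Some B"
    using mat_inverse(1)[OF T, where b = "()"] by (cases "mat_inverse ?T") blast+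
  show thesis
    using that[OF B] mat_inverse(2)[OF T B] by blast
qed

definition matC :: "real \<Rightarrow> nat \<Rightarrow> real mat" where
  "matC \<delta> n = - (the (mat_inverse (matL \<delta> n + matD \<delta> n)) * transpose_mat (matL \<delta> n))"

definition coef_d2 :: "real \<Rightarrow> nat \<Rightarrow> real" where
  "coef_d2 \<delta> n =
    ((euclid_norm (matC \<delta> n *\<^sub>v ones n))\<^sup>2 - (frob_norm (matC \<delta> n))\<^sup>2) / (real n * (real n - 1))"

definition coef_d1 :: "real \<Rightarrow> nat \<Rightarrow> real" where
  "coef_d1 \<delta> n = (frob_norm (matC \<delta> n))\<^sup>2 / real n - coef_d2 \<delta> n"

definition coef_m2 :: "real \<Rightarrow> nat \<Rightarrow> real" where
  "coef_m2 \<delta> n =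
    ((ones n \<bullet> (matC \<delta> n *\<^sub>v ones n))\<^sup>2 - (euclid_norm (transpose_mat (matC \<delta> n) *\<^sub>v ones n))\<^sup>2)
      / (real n * (real n - 1))"

definition coef_m1 :: "real \<Rightarrow> nat \<Rightarrow> real" where
  "coef_m1 \<delta> n =
    (euclid_norm (transpose_mat (matC \<delta> n) *\<^sub>v ones n))\<^sup>2 / real n - coef_m2 \<delta> n"

definition matM :: "real \<Rightarrow> nat \<Rightarrow> real mat" where
  "matM \<delta> n = mat_of_rows_list 2
    [[coef_d1 \<delta> n, coef_m1 \<delta> n],
     [coef_d2 \<delta> n, coef_m2 \<delta> n]]"

(* The library's spectral radius is defined for complex matrices. *)
definition real_spectral_radius :: "real mat \<Rightarrow> real" where
  "real_spectral_radius B = spectral_radius (map_mat complex_of_real B)"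

end

theory Submission
  imports Defs
begin

text \<open>
  Forward substitution gives \<open>C\<^sub>i\<^sub>j = (1 - \<delta>) ([j \<le> i] \<delta>\<^bsup>i - j\<^esup> - \<delta>\<^bsup>i\<^esup>)\<close> (indices from 0), so the
  \<open>j\<close>-th column sum is \<open>\<delta>\<^bsup>n\<^esup> - \<delta>\<^bsup>n - j\<^esup>\<close>. Hence \<open>m\<^sub>1\<close> and \<open>m\<^sub>2\<close> are \<open>O(\<delta>\<^sup>2 / n)\<close>, while
  \<open>d\<^sub>2 = O(1)\<close> and \<open>d\<^sub>1\<close> stays away from 0, so the spectral radius is \<open>d\<^sub>1 + O(\<delta>\<^sup>2 / n)\<close>. In
  \<open>n (n - 1) d\<^sub>1 = n \<parallel>C\<parallel>\<^sub>F\<^sup>2 - \<parallel>C 1\<parallel>\<^sup>2\<close> the large terms \<open>(1 - \<delta>)\<^sup>2 n\<^sup>2 \<delta>\<^bsup>2 i\<^esup>\<close> of each row cancel; with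
  \<open>r = (1 - \<delta>) / (1 + \<delta>) = 1 - 2 \<delta> + 2 \<delta>\<^sup>2 + O(\<delta>\<^sup>3)\<close>, row \<open>i\<close> contributes
  \<open>n r (1 - \<delta>\<^bsup>2 i + 2\<^esup>) - (1 - \<delta>\<^bsup>i + 1\<^esup>)\<^sup>2\<close>, and summing over \<open>i\<close> yields the expansion of \<open>d\<^sub>1\<close>.
\<close>

section \<open>Closed form of \<open>matC\<close>\<close>

definition c_entry :: "real \<Rightarrow> nat \<Rightarrow> nat \<Rightarrow> real" where
  "c_entry \<delta> i j = (1 - \<delta>) * ((if j \<le> i then \<delta> ^ (i - j) else 0) - \<delta> ^ i)"

text \<open>The factor \<open>1 - \<delta>\<close> makes both geometric sums telescope. The partial
  sum up to \<open>i\<close> is what forward substitution in row \<open>i\<close> needs;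
  \<open>i = n\<close> gives the full column sum. At \<open>j = i\<close> the two branches agree, so
  the step where \<open>j = Suc i\<close> is harmless.\<close>

lemma sum_c_entry_col:
  "(\<Sum>k<i. c_entry \<delta> k j) = (if j \<le> i then 1 - \<delta> ^ (i - j) else 0) - (1 - \<delta> ^ i)"
proof (induction i)
  case (Suc i)
  show ?case
  proof (cases "j \<le> i")
    case True
    then show ?thesis using Suc by (simp add: c_entry_def Suc_diff_le algebra_simps)
  next
    case False
    then show ?thesis using Suc by (cases "j = Suc i") (auto simp: c_entry_def algebra_simps)
  qed
qed simp

text \<open>The inverse of \<open>L + D\<close> is never computed: the candidate \<open>X\<close> is
  checked to solve \<open>(L + D) X = - L^T\<close>, and multiplying by the left inverse
  \<open>B\<close> identifies it.\<close>

lemma matC_eq: "matC \<delta> n = mat n n (\<lambda>(i, j). c_entry \<delta> i j)"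
proof -
  define X where "X = mat n n (\<lambda>(i, j). c_entry \<delta> i j)"
  have X: "X \<in> carrier_mat n n" by (simp add: X_def)
  let ?T = "matL \<delta> n + matD \<delta> n"
  let ?U = "transpose_mat (matL \<delta> n)"
  obtain B where B: "mat_inverse ?T = Some B" "B \<in> carrier_mat n n" "B * ?T = 1\<^sub>m n"
    by (rule mat_inverse_L_plus_D)
  have L: "matL \<delta> n \<in> carrier_mat n n" and T: "?T \<in> carrier_mat n n"
    using matL_carrier matD_carrier by simp_all
  have U: "?U \<in> carrier_mat n n" using L by simp
  have dims: "dim_row (matL \<delta> n) = n" "dim_col (matL \<delta> n) = n" using L by auto
  have L_entry: "matL \<delta> n $$ (i, j) = (if j < i then 1 - \<delta> else 0)" if "i < n" "j < n" for i j
    using that by (simp add: matL_def matA_def outer_def ones_def strict_lower_part_def)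
  have "?T * X = - ?U"
  proof (rule eq_matI)
    fix i j assume "i < dim_row (- ?U)" "j < dim_col (- ?U)"
    then have ij: "i < n" "j < n" using U by auto
    have "(?T * X) $$ (i, j) = (\<Sum>k<n. ?T $$ (i, k) * c_entry \<delta> k j)"
      using ij dims
      by (auto simp: X_def scalar_prod_def lessThan_atLeast0 matD_eq_one intro!: sum.cong)
    \<comment> \<open>Row \<open>i\<close> of \<open>L + D\<close> is \<open>1 - \<delta>\<close>
      before the diagonal, 1 on it and 0 after it.\<close>
    also have "\<dots> = (\<Sum>k<n. (if k < i then (1 - \<delta>) * c_entry \<delta> k j else 0)
        + (if k = i then c_entry \<delta> k j else 0))"
      using ij by (intro sum.cong) (auto simp: L_entry matD_eq_one)
    also have "\<dots> = (1 - \<delta>) * (\<Sum>k<i. c_entry \<delta> k j) + c_entry \<delta> i j"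
    proof -
      have "(\<Sum>k<n. if k < i then (1 - \<delta>) * c_entry \<delta> k j else 0)
          = (\<Sum>k<i. (1 - \<delta>) * c_entry \<delta> k j)"
        using ij by (intro sum.mono_neutral_cong_right) auto
      then show ?thesis using ij by (simp add: sum.distrib sum_distrib_left)
    qed
    \<comment> \<open>All powers of \<delta> cancel: what is left is 0 for \<open>j \<le> i\<close>
      and \<open>-(1 - \<delta>)\<close> for \<open>j > i\<close>.\<close>
    also have "\<dots> = (- ?U) $$ (i, j)"
      unfolding sum_c_entry_col using ij L by (auto simp: c_entry_def L_entry algebra_simps)
    finally show "(?T * X) $$ (i, j) = (- ?U) $$ (i, j)" .
  qed (use T U X in auto)
  then have "B * (- ?U) = X"
    using assoc_mult_mat[OF B(2) T X] B(3) X by simp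
  then show ?thesis
    using B U by (simp add: matC_def X_def)
qed

section \<open>Row sums and row square sums\<close>

lemma sum_if_le_diff:
  fixes f :: "nat \<Rightarrow> real"
  assumes "i < n"
  shows "(\<Sum>j<n. if j \<le> i then f (i - j) else 0) = (\<Sum>k\<le>i. f k)"
proof -
  have "(\<Sum>j<n. if j \<le> i then f (i - j) else 0) = (\<Sum>j\<le>i. f (i - j))"
    using assms by (intro sum.mono_neutral_cong_right) auto
  also have "\<dots> = (\<Sum>k\<le>i. f k)"
    by (rule sum.reindex_bij_witness[of _ "\<lambda>k. i - k" "\<lambda>k. i - k"]) auto
  finally show ?thesis .
qed

lemma one_minus_times_gp: "(1 - x) * (\<Sum>k\<le>i. x ^ k) = 1 - x * x ^ i" for x :: real
  using sum_gp_basic[of x i] by simp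

text \<open>The right side is kept as a polynomial in \<delta>, \<open>n\<close> and
  \<open>\<delta> ^ i\<close>, so that its square can later be compared with
  \<open>sum_c_entry_row_sq\<close> by plain algebra.\<close>

lemma sum_c_entry_row:
  assumes "i < n"
  shows "(\<Sum>j<n. c_entry \<delta> i j) = 1 - \<delta> * \<delta> ^ i - (1 - \<delta>) * real n * \<delta> ^ i"
proof -
  have "(\<Sum>j<n. c_entry \<delta> i j)
      = (1 - \<delta>) * ((\<Sum>j<n. if j \<le> i then \<delta> ^ (i - j) else 0) - (\<Sum>j<n. \<delta> ^ i))"
    by (simp add: c_entry_def sum_distrib_left sum_subtractf[symmetric] del: sum_constant)
  then show ?thesis
    using one_minus_times_gp[of \<delta> i] by (simp add: sum_if_le_diff[OF assms] algebra_simps)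
qed

text \<open>Squaring the indicator term leaves geometric sums of ratio
  \<open>\<delta>\<^sup>2\<close> and \<delta> and a constant term.\<close>

lemma sum_c_entry_row_sq:
  assumes "i < n" "\<delta> \<noteq> -1"
  shows "(\<Sum>j<n. (c_entry \<delta> i j)\<^sup>2) = (1 - \<delta>) / (1 + \<delta>) * (1 - \<delta>\<^sup>2 * (\<delta> ^ i)\<^sup>2)
    - 2 * (1 - \<delta>) * \<delta> ^ i * (1 - \<delta> * \<delta> ^ i) + (1 - \<delta>)\<^sup>2 * real n * (\<delta> ^ i)\<^sup>2"
proof -
  let ?q = "\<delta> ^ i"
  have sq: "(c_entry \<delta> i j)\<^sup>2 = (1 - \<delta>)\<^sup>2 * ((if j \<le> i then (\<delta>\<^sup>2) ^ (i - j) else 0)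
      - 2 * ?q * (if j \<le> i then \<delta> ^ (i - j) else 0) + ?q\<^sup>2)" for j
    by (simp add: c_entry_def power2_eq_square power_mult_distrib algebra_simps)
  have "(\<Sum>j<n. (c_entry \<delta> i j)\<^sup>2) = (1 - \<delta>)\<^sup>2 * ((\<Sum>j<n. if j \<le> i then (\<delta>\<^sup>2) ^ (i - j) else 0)
      - 2 * ?q * (\<Sum>j<n. if j \<le> i then \<delta> ^ (i - j) else 0) + real n * ?q\<^sup>2)"
    unfolding sq by (simp only: sum_distrib_left[symmetric] sum.distrib sum_subtractf) simp
  also have "\<dots> = (1 - \<delta>)\<^sup>2 * (\<Sum>k\<le>i. (\<delta>\<^sup>2) ^ k)
      - 2 * (1 - \<delta>) * ?q * ((1 - \<delta>) * (\<Sum>k\<le>i. \<delta> ^ k)) + (1 - \<delta>)\<^sup>2 * real n * ?q\<^sup>2"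
    unfolding sum_if_le_diff[OF assms(1), of "\<lambda>k. (\<delta>\<^sup>2) ^ k"]
      sum_if_le_diff[OF assms(1), of "\<lambda>k. \<delta> ^ k"]
    by (simp add: power2_eq_square algebra_simps)
  \<comment> \<open>Splitting off the factor \<open>1 - \<delta>\<^sup>2\<close> lets the sum of
    ratio \<open>\<delta>\<^sup>2\<close> telescope without dividing by
    \<open>1 - \<delta>\<close>.\<close>
  also have "(1 - \<delta>)\<^sup>2 * (\<Sum>k\<le>i. (\<delta>\<^sup>2) ^ k) = (1 - \<delta>) / (1 + \<delta>) * (1 - \<delta>\<^sup>2 * ?q\<^sup>2)"
  proof -
    have "(1 - \<delta>)\<^sup>2 = (1 - \<delta>) / (1 + \<delta>) * (1 - \<delta>\<^sup>2)"
      using assms(2) by (simp add: field_simps power2_eq_square add_eq_0_iff)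
    then show ?thesis
      using one_minus_times_gp[of "\<delta>\<^sup>2" i] by (simp add: power_mult[symmetric] mult.commute)
  qed
  finally show ?thesis by (simp only: one_minus_times_gp)
qed

section \<open>The norms as sums over entries\<close>

definition row_norm_sq :: "real \<Rightarrow> nat \<Rightarrow> real" where
  "row_norm_sq \<delta> n = (\<Sum>i<n. (\<Sum>j<n. c_entry \<delta> i j)\<^sup>2)"

definition frob_sq :: "real \<Rightarrow> nat \<Rightarrow> real" where
  "frob_sq \<delta> n = (\<Sum>i<n. \<Sum>j<n. (c_entry \<delta> i j)\<^sup>2)"

definition col_norm_sq :: "real \<Rightarrow> nat \<Rightarrow> real" where
  "col_norm_sq \<delta> n = (\<Sum>j<n. (\<Sum>i<n. c_entry \<delta> i j)\<^sup>2)"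

definition total_sum :: "real \<Rightarrow> nat \<Rightarrow> real" where
  "total_sum \<delta> n = (\<Sum>j<n. \<Sum>i<n. c_entry \<delta> i j)"

lemma euclid_norm_sq: "(euclid_norm v)\<^sup>2 = (\<Sum>i<dim_vec v. (v $ i)\<^sup>2)"
proof -
  have "v \<bullet> v = (\<Sum>i<dim_vec v. (v $ i)\<^sup>2)"
    by (simp add: scalar_prod_def lessThan_atLeast0 power2_eq_square)
  then show ?thesis by (simp add: euclid_norm_def sum_nonneg)
qed

lemma matC_mult_ones: "matC \<delta> n *\<^sub>v ones n = vec n (\<lambda>i. \<Sum>j<n. c_entry \<delta> i j)"
  by (rule eq_vecI) (auto simp: matC_eq ones_def scalar_prod_def lessThan_atLeast0)

lemma euclid_norm_matC_ones: "(euclid_norm (matC \<delta> n *\<^sub>v ones n))\<^sup>2 = row_norm_sq \<delta> n"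
  by (simp add: matC_mult_ones euclid_norm_sq row_norm_sq_def)

lemma euclid_norm_matC_transpose_ones:
  "(euclid_norm (transpose_mat (matC \<delta> n) *\<^sub>v ones n))\<^sup>2 = col_norm_sq \<delta> n"
proof -
  have "transpose_mat (matC \<delta> n) *\<^sub>v ones n = vec n (\<lambda>j. \<Sum>i<n. c_entry \<delta> i j)"
    by (rule eq_vecI) (auto simp: matC_eq ones_def scalar_prod_def lessThan_atLeast0)
  then show ?thesis by (simp add: euclid_norm_sq col_norm_sq_def)
qed

lemma frob_norm_matC: "(frob_norm (matC \<delta> n))\<^sup>2 = frob_sq \<delta> n"
  by (simp add: frob_norm_def matC_eq frob_sq_def sum_nonneg)

lemma ones_matC_ones: "ones n \<bullet> (matC \<delta> n *\<^sub>v ones n) = total_sum \<delta> n"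
proof -
  have "ones n \<bullet> (matC \<delta> n *\<^sub>v ones n) = (\<Sum>i<n. \<Sum>j<n. c_entry \<delta> i j)"
    unfolding matC_mult_ones by (simp add: ones_def scalar_prod_def lessThan_atLeast0)
  also have "\<dots> = total_sum \<delta> n" unfolding total_sum_def by (rule sum.swap)
  finally show ?thesis .
qed

section \<open>Spectral radius of real 2 by 2 matrices\<close>

lemma det_2x2:
  fixes A :: "'a :: comm_ring_1 mat"
  assumes A: "A \<in> carrier_mat 2 2"
  shows "det A = A $$ (0, 0) * A $$ (1, 1) - A $$ (0, 1) * A $$ (1, 0)"
proof -
  have "det (mat_delete A 0 j) = mat_delete A 0 j $$ (0, 0)" for j
    using A by (intro det_single) (simp add: mat_delete_def)
  then show ?thesis
    using A by (simp add: laplace_expansion_row[OF A, of 0] cofactor_def numeral_2_eq_2 mat_delete_def)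
qed

text \<open>A nonnegative discriminant makes both eigenvalues \<open>p\<close> and \<open>q\<close>
  real, and a nonnegative trace makes the larger one dominate in absolute value.\<close>

lemma spectral_radius_2x2:
  fixes a b c d :: real
  defines "D \<equiv> (a - d)\<^sup>2 + 4 * b * c"
  assumes "D \<ge> 0" "a + d \<ge> 0"
  shows "real_spectral_radius (mat_of_rows_list 2 [[a, b], [c, d]]) = (a + d + sqrt D) / 2"
proof -
  let ?A = "map_mat complex_of_real (mat_of_rows_list 2 [[a, b], [c, d]])"
  define p q where "p = (a + d + sqrt D) / 2" and "q = (a + d - sqrt D) / 2"
  have A: "?A \<in> carrier_mat 2 2" by (simp add: mat_of_rows_list_def numeral_2_eq_2)
  have "poly (char_poly ?A) x = (x - a) * (x - d) - b * c" for x :: complex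
  proof -
    have "char_poly ?A = [:- complex_of_real a, 1:] * [:- complex_of_real d, 1:] - [:of_real b:] * [:of_real c:]"
      unfolding char_poly_def
      by (subst det_2x2) (simp_all add: char_poly_matrix_def mat_of_rows_list_def numeral_2_eq_2)
    then show ?thesis by (simp add: algebra_simps)
  qed
  moreover have "(x - a) * (x - d) - b * c = (x - p) * (x - q)" for x :: complex
  proof -
    have "p + q = a + d" "p * q = a * d - b * c"
      using assms(2) by (simp_all add: p_def q_def field_simps D_def power2_eq_square)
    then have "complex_of_real p + q = a + d" "complex_of_real p * q = a * d - b * c"
      by (metis of_real_add, metis of_real_diff of_real_mult)
    moreover have "(x - a) * (x - d) - b * c = x * x - x * complex_of_real (a + d) + complex_of_real (a * d - b * c)"
      "(x - p) * (x - q) = x * x - x * (complex_of_real p + q) + complex_of_real p * q"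
      by (simp_all add: algebra_simps)
    ultimately show ?thesis by simp
  qed
  ultimately have "spectrum ?A = {complex_of_real p, complex_of_real q}"
    by (auto simp: spectrum_def eigenvalue_root_char_poly[OF A])
  then have "real_spectral_radius (mat_of_rows_list 2 [[a, b], [c, d]]) = max \<bar>p\<bar> \<bar>q\<bar>"
    by (simp add: real_spectral_radius_def spectral_radius_def)
  also have "\<dots> = p"
  proof -
    have "0 \<le> sqrt D" using assms(2) by simp
    then have "\<bar>q\<bar> \<le> p" "0 \<le> p" using assms(3) by (simp_all add: p_def q_def abs_le_iff)
    then show ?thesis by simp
  qed
  finally show ?thesis by (simp add: p_def)
qed

text \<open>For the root \<open>s\<close> of the discriminant,
  \<open>(s - (a - d)) * (s + (a - d)) = 4 * b * c\<close>. The gap bounds the second factor below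
  by 1/2, so the first is at most \<open>8 * \<bar>b * c\<bar>\<close>, and the error is half of it.
  The bound 1/16 keeps the discriminant nonnegative, as 1/4 - 4/16 = 0.\<close>

lemma spectral_radius_2x2_perturbation:
  fixes a b c d :: real
  assumes "a - d \<ge> 1/2" "a + d \<ge> 0" "\<bar>b * c\<bar> \<le> 1/16"
  shows "\<bar>real_spectral_radius (mat_of_rows_list 2 [[a, b], [c, d]]) - a\<bar> \<le> 4 * \<bar>b * c\<bar>"
proof -
  define s where "s = sqrt ((a - d)\<^sup>2 + 4 * b * c)"
  have "(1/2)\<^sup>2 \<le> (a - d)\<^sup>2" using assms(1) by (intro power_mono) auto
  then have D: "(a - d)\<^sup>2 + 4 * b * c \<ge> 0"
    using assms(3) by (simp add: power2_eq_square abs_le_iff)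
  then have s: "s \<ge> 0" "s\<^sup>2 = (a - d)\<^sup>2 + 4 * b * c" by (simp_all add: s_def)
  have "(s - (a - d)) * (s + (a - d)) = 4 * (b * c)"
    using s(2) by (simp add: power2_eq_square algebra_simps)
  then have "\<bar>s - (a - d)\<bar> * (s + (a - d)) = 4 * \<bar>b * c\<bar>"
    using s(1) assms(1) abs_mult[of "s - (a - d)" "s + (a - d)"] abs_mult[of 4 "b * c"]
    by simp
  moreover have "\<bar>s - (a - d)\<bar> * (1/2) \<le> \<bar>s - (a - d)\<bar> * (s + (a - d))"
    using s(1) assms(1) by (intro mult_left_mono) auto
  ultimately have "\<bar>s - (a - d)\<bar> / 2 \<le> 4 * \<bar>b * c\<bar>" by simp
  moreover have "real_spectral_radius (mat_of_rows_list 2 [[a, b], [c, d]]) - a = (s - (a - d)) / 2"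
    using spectral_radius_2x2[OF D assms(2)] by (simp add: s_def field_simps)
  ultimately show ?thesis by simp
qed

section \<open>Estimates of the geometric sums, the norms and the column sums\<close>

lemma geometric_sum_bounds:
  fixes \<delta> :: real
  assumes "0 < \<delta>" "\<delta> \<le> 1/20" "n > 0"
  shows "1 \<le> (\<Sum>i<n. \<delta> ^ i)" "(\<Sum>i<n. \<delta> ^ i) \<le> 1 + 2 * \<delta>"
    "0 \<le> (\<Sum>i<n. (\<delta> ^ i)\<^sup>2)" "(\<Sum>i<n. (\<delta> ^ i)\<^sup>2) \<le> 2"
proof -
  let ?S = "\<Sum>i<n. \<delta> ^ i"
  have eq: "(1 - \<delta>) * ?S = 1 - \<delta> ^ n"
    using assms by (simp add: sum_gp_strict)
  have "\<delta> ^ n \<le> \<delta> ^ 1" using assms by (intro power_decreasing) auto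
  then have "(1 - \<delta>) * 1 \<le> (1 - \<delta>) * ?S" using eq by simp
  then show "1 \<le> ?S" using assms by (simp del: mult_1_right)
  have "(1 - \<delta>) * ?S \<le> 1" using eq assms by simp
  also have "1 \<le> (1 - \<delta>) * (1 + 2 * \<delta>)"
    using mult_left_mono[of \<delta> "1/2" \<delta>] assms by (simp add: algebra_simps)
  finally show le: "?S \<le> 1 + 2 * \<delta>" using assms by simp
  show "0 \<le> (\<Sum>i<n. (\<delta> ^ i)\<^sup>2)" by (simp add: sum_nonneg)
  have "(\<Sum>i<n. (\<delta> ^ i)\<^sup>2) \<le> ?S"
    using assms by (intro sum_mono) (auto simp: power2_eq_square intro!: mult_left_le power_le_one)
  then show "(\<Sum>i<n. (\<delta> ^ i)\<^sup>2) \<le> 2" using le assms by simp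
qed

text \<open>Treating the two norms together, row by row, also cancels the cross terms \<open>2 * (1
  - \<delta>) * n * \<delta> ^ i * (1 - \<delta> * \<delta> ^ i)\<close>, which leaves only two
  geometric sums.\<close>

lemma frob_row_difference:
  assumes "\<delta> \<noteq> -1"
  defines "r \<equiv> (1 - \<delta>) / (1 + \<delta>)"
  shows "real n * frob_sq \<delta> n - row_norm_sq \<delta> n
    = (real n)\<^sup>2 * r - real n + 2 * \<delta> * (\<Sum>i<n. \<delta> ^ i)
      - (real n * r + 1) * \<delta>\<^sup>2 * (\<Sum>i<n. (\<delta> ^ i)\<^sup>2)"
proof -
  have "real n * frob_sq \<delta> n - row_norm_sq \<delta> n
      = (\<Sum>i<n. real n * (\<Sum>j<n. (c_entry \<delta> i j)\<^sup>2) - (\<Sum>j<n. c_entry \<delta> i j)\<^sup>2)"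
    by (simp add: frob_sq_def row_norm_sq_def sum_distrib_left sum_subtractf)
  also have "\<dots> = (\<Sum>i<n. (real n * r - 1) + 2 * \<delta> * \<delta> ^ i - (real n * r + 1) * \<delta>\<^sup>2 * (\<delta> ^ i)\<^sup>2)"
  proof (rule sum.cong[OF refl])
    fix i assume "i \<in> {..<n}"
    then have i: "i < n" by simp
    show "real n * (\<Sum>j<n. (c_entry \<delta> i j)\<^sup>2) - (\<Sum>j<n. c_entry \<delta> i j)\<^sup>2
        = (real n * r - 1) + 2 * \<delta> * \<delta> ^ i - (real n * r + 1) * \<delta>\<^sup>2 * (\<delta> ^ i)\<^sup>2"
      unfolding sum_c_entry_row[OF i] sum_c_entry_row_sq[OF i assms(1)] r_def[symmetric]
      by (simp add: power2_eq_square algebra_simps)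
  qed
  also have "\<dots> = real n * (real n * r - 1) + 2 * \<delta> * (\<Sum>i<n. \<delta> ^ i)
      - (real n * r + 1) * \<delta>\<^sup>2 * (\<Sum>i<n. (\<delta> ^ i)\<^sup>2)"
    by (simp only: sum.distrib sum_subtractf sum_distrib_left[symmetric]) (simp add: right_diff_distrib)
  finally show ?thesis by (simp add: power2_eq_square right_diff_distrib)
qed

text \<open>A crude bound is enough, since it only serves to bound \<open>coef_d2\<close>, which
  enters multiplied by the small \<open>coef_m1\<close>. In each row the first term is at most 1 and
  the subtracted cross term is dropped.\<close>

lemma frob_sq_bounds:
  assumes "0 < \<delta>" "\<delta> \<le> 1/20" "n > 0"
  shows "0 \<le> frob_sq \<delta> n" "frob_sq \<delta> n \<le> 3 * real n"
proof -
  show "0 \<le> frob_sq \<delta> n" by (simp add: frob_sq_def sum_nonneg)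
  have "frob_sq \<delta> n \<le> (\<Sum>i<n. 1 + real n * (\<delta> ^ i)\<^sup>2)"
    unfolding frob_sq_def
  proof (rule sum_mono)
    fix i assume "i \<in> {..<n}"
    then have i: "i < n" by simp
    let ?q = "\<delta> ^ i"
    have q: "0 < ?q" "?q \<le> 1" using assms by (auto intro: power_le_one)
    have "(1 - \<delta>) / (1 + \<delta>) * (1 - \<delta>\<^sup>2 * ?q\<^sup>2) \<le> 1 * 1"
    proof (rule mult_mono)
      show "0 \<le> 1 - \<delta>\<^sup>2 * ?q\<^sup>2"
        using q assms by (simp add: power_mult_distrib[symmetric] mult_le_one power_le_one)
    qed (use assms in auto)
    moreover have "0 \<le> 2 * (1 - \<delta>) * ?q * (1 - \<delta> * ?q)"
      using q assms by (simp add: mult_le_one)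
    moreover have "(1 - \<delta>)\<^sup>2 * (real n * ?q\<^sup>2) \<le> 1 * (real n * ?q\<^sup>2)"
      using assms by (intro mult_right_mono) (auto simp: power_le_one)
    ultimately show "(\<Sum>j<n. (c_entry \<delta> i j)\<^sup>2) \<le> 1 + real n * ?q\<^sup>2"
      using sum_c_entry_row_sq[OF i, of \<delta>] assms(1)
      by (simp only: mult.assoc[of _ "real n"])
  qed
  also have "\<dots> = real n + real n * (\<Sum>i<n. (\<delta> ^ i)\<^sup>2)"
    by (simp add: sum.distrib sum_distrib_left)
  also have "\<dots> \<le> real n + real n * 2"
    using geometric_sum_bounds(4)[OF assms] by (intro add_left_mono mult_left_mono) auto
  finally show "frob_sq \<delta> n \<le> 3 * real n" by simp
qed

text \<open>Column sum \<open>j\<close> lies between \<open>- \<delta> ^ (n - j)\<close> and 0.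
  Summing these geometric bounds controls the total; one more factor \<delta>, the uniform bound,
  controls the sum of squares.\<close>

lemma col_sum_bounds:
  assumes "0 < \<delta>" "\<delta> \<le> 1/20" "n > 0"
  shows "\<bar>total_sum \<delta> n\<bar> \<le> 2 * \<delta>" "0 \<le> col_norm_sq \<delta> n" "col_norm_sq \<delta> n \<le> 2 * \<delta>\<^sup>2"
proof -
  define t where "t j = (\<Sum>i<n. c_entry \<delta> i j)" for j
  have t: "\<bar>t j\<bar> \<le> \<delta> ^ (n - j)" "\<bar>t j\<bar> \<le> \<delta>" if "j < n" for j
  proof -
    have "\<delta> ^ n \<le> \<delta> ^ (n - j)" "0 \<le> \<delta> ^ n" using assms by (auto intro: power_decreasing)
    then show *: "\<bar>t j\<bar> \<le> \<delta> ^ (n - j)"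
      using that by (simp add: t_def sum_c_entry_col)
    have "\<delta> ^ (n - j) \<le> \<delta> ^ 1" using assms that by (intro power_decreasing) auto
    then show "\<bar>t j\<bar> \<le> \<delta>" using * by simp
  qed
  have "(\<Sum>j<n. \<delta> ^ (n - j)) = (\<Sum>i<n. \<delta> * \<delta> ^ i)"
    unfolding power_Suc[symmetric]
    by (rule sum.reindex_bij_witness[of _ "\<lambda>i. n - Suc i" "\<lambda>j. n - Suc j"]) (auto simp: Suc_diff_Suc)
  also have "\<dots> \<le> \<delta> * 2"
    using geometric_sum_bounds(2)[OF assms] assms
    unfolding sum_distrib_left[symmetric] by (intro mult_left_mono) auto
  finally have "(\<Sum>j<n. \<bar>t j\<bar>) \<le> 2 * \<delta>"
    using sum_mono[of "{..<n}" "\<lambda>j. \<bar>t j\<bar>" "\<lambda>j. \<delta> ^ (n - j)"] t(1) by simp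
  then show "\<bar>total_sum \<delta> n\<bar> \<le> 2 * \<delta>"
    using sum_abs[of t "{..<n}"] unfolding total_sum_def t_def by linarith
  show "0 \<le> col_norm_sq \<delta> n" by (simp add: col_norm_sq_def sum_nonneg)
  have "col_norm_sq \<delta> n = (\<Sum>j<n. \<bar>t j\<bar> * \<bar>t j\<bar>)"
    by (simp add: col_norm_sq_def t_def power2_eq_square)
  also have "\<dots> \<le> (\<Sum>j<n. \<delta> * \<bar>t j\<bar>)"
    using t(2) by (intro sum_mono mult_right_mono) auto
  also have "\<dots> \<le> \<delta> * (2 * \<delta>)"
    using \<open>(\<Sum>j<n. \<bar>t j\<bar>) \<le> 2 * \<delta>\<close> assms
    unfolding sum_distrib_left[symmetric] by (intro mult_left_mono) auto
  finally show "col_norm_sq \<delta> n \<le> 2 * \<delta>\<^sup>2" by (simp add: power2_eq_square)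
qed

text \<open>The loss from 5 to 6 pays for replacing \<open>n - 1\<close> by \<open>n\<close>:
  \<open>5 * n \<le> 6 * (n - 1)\<close> holds from \<open>n = 6\<close> on.\<close>

lemma div_choose_le:
  fixes x :: real
  assumes "\<bar>x\<bar> \<le> 5 * (real n * y)" "n \<ge> 6" "y \<ge> 0"
  shows "\<bar>x / (real n * (real n - 1))\<bar> \<le> 6 * (y / real n)"
proof -
  have pos: "0 < real n * (real n - 1)" using assms(2) by simp
  have "5 * real n * y \<le> 6 * (real n - 1) * y"
    using assms by (intro mult_right_mono) auto
  then have "\<bar>x\<bar> \<le> 6 * (y / real n) * (real n * (real n - 1))"
    using assms(1,2) by (simp add: mult_ac)
  then show ?thesis using pos by (simp add: abs_divide pos_divide_le_eq del: times_divide_eq_right)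
qed

section \<open>Asymptotics of the four coefficients and of the spectral radius\<close>

context
  fixes \<delta> :: real and n :: nat
  assumes \<delta>: "0 < \<delta>" "\<delta> \<le> 1/20" and n: "10 \<le> n"
begin

lemma n_pos: "n > 0" using n by simp

lemma coef_d1_eq:
  "coef_d1 \<delta> n = (real n * frob_sq \<delta> n - row_norm_sq \<delta> n) / (real n * (real n - 1))"
  using n by (simp add: coef_d1_def coef_d2_def frob_norm_matC euclid_norm_matC_ones field_simps)

lemma coef_d1_asymp:
  "\<bar>coef_d1 \<delta> n - (1 - 2 * \<delta> - 2 * \<delta> / real n + 2 * \<delta>\<^sup>2)\<bar> \<le> 6 * (\<delta>\<^sup>2 / real n) + 2 * \<delta> ^ 3"
proof -
  define r where "r = (1 - \<delta>) / (1 + \<delta>)"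
  define S1 where "S1 = (\<Sum>i<n. \<delta> ^ i)"
  define S2 where "S2 = (\<Sum>i<n. (\<delta> ^ i)\<^sup>2)"
  define N where "N = real n * (real n - 1)"
  have N: "N \<noteq> 0" using n by (simp add: N_def)
  have S: "1 \<le> S1" "S1 \<le> 1 + 2 * \<delta>" "0 \<le> S2" "S2 \<le> 2"
    using geometric_sum_bounds[OF \<delta> n_pos] by (simp_all add: S1_def S2_def)
  have r: "0 \<le> r" "r \<le> 1" using \<delta> by (simp_all add: r_def)
  \<comment> \<open>The remainders: \<open>u\<close> is the tail of \<open>2 * \<delta> * S1\<close>
    beyond its first term, \<open>v\<close> the second-order part of \<open>n * (r - 1)\<close>, and
    \<open>w\<close> the \<open>S2\<close> term. The first-order parts combine to
    \<open>- 2 * \<delta> * (n - 1)\<close>, which after division by \<open>N\<close> is exactly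
    \<open>- 2 * \<delta> / n\<close>.\<close>
  define u where "u = 2 * (\<delta> * (S1 - 1))"
  define v where "v = 2 * \<delta>\<^sup>2 * real n / (1 + \<delta>)"
  define w where "w = (real n * r + 1) * \<delta>\<^sup>2 * S2"
  have rn: "real n * r - real n = - 2 * \<delta> * real n + v"
    using \<delta> by (simp add: r_def v_def field_simps power2_eq_square)
  have "coef_d1 \<delta> n = (N * r + (real n * r - real n) + 2 * \<delta> * S1 - w) / N"
    using \<delta> unfolding coef_d1_eq
    by (subst frob_row_difference)
      (simp_all add: N_def S1_def S2_def w_def r_def[symmetric] power2_eq_square algebra_simps)
  also have "\<dots> = (N * r + (- 2 * \<delta> * (real n - 1)) + (u + v - w)) / N"
    unfolding rn by (simp add: u_def algebra_simps)
  also have "\<dots> = r + (- 2 * \<delta> * (real n - 1)) / N + (u + v - w) / N"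
    using N by (simp add: add_divide_distrib diff_divide_distrib)
  also have "(- 2 * \<delta> * (real n - 1)) / N = - 2 * \<delta> / real n"
    using n by (simp add: N_def)
  finally have d1: "coef_d1 \<delta> n = r - 2 * \<delta> / real n + (u + v - w) / N" by simp
  have "\<bar>u\<bar> \<le> 2 * (\<delta> * (2 * \<delta>))"
    using S \<delta> by (simp add: u_def abs_mult)
  moreover have "\<bar>v\<bar> \<le> 2 * \<delta>\<^sup>2 * real n"
  proof -
    have "2 * \<delta>\<^sup>2 * real n * 1 \<le> 2 * \<delta>\<^sup>2 * real n * (1 + \<delta>)"
      using \<delta> by (intro mult_left_mono) auto
    then show ?thesis using \<delta> by (simp add: v_def pos_divide_le_eq del: mult_1_right)
  qed
  moreover have "\<bar>w\<bar> \<le> (real n * 1 + 1) * \<delta>\<^sup>2 * 2"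
  proof -
    have "w \<le> (real n * 1 + 1) * \<delta>\<^sup>2 * 2"
      unfolding w_def using S r by (intro mult_mono add_right_mono mult_left_mono) auto
    moreover have "w \<ge> 0" using S r by (simp add: w_def)
    ultimately show ?thesis by simp
  qed
  moreover have "10 * \<delta>\<^sup>2 \<le> real n * \<delta>\<^sup>2" using n by (intro mult_right_mono) auto
  \<comment> \<open>The three bounds add up to \<open>(4 * n + 6) * \<delta>\<^sup>2\<close>, and
    \<open>6 \<le> n\<close>.\<close>
  ultimately have "\<bar>u + v - w\<bar> \<le> 5 * (real n * \<delta>\<^sup>2)"
    by (simp add: power2_eq_square algebra_simps)
  then have "\<bar>(u + v - w) / N\<bar> \<le> 6 * (\<delta>\<^sup>2 / real n)"
    unfolding N_def using n by (intro div_choose_le) auto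
  moreover have "r - (1 - 2 * \<delta> + 2 * \<delta>\<^sup>2) = - (2 * \<delta> ^ 3 / (1 + \<delta>))"
    using \<delta> by (simp add: r_def field_simps power2_eq_square power3_eq_cube)
  moreover have "0 \<le> 2 * \<delta> ^ 3 / (1 + \<delta>)" "2 * \<delta> ^ 3 / (1 + \<delta>) \<le> 2 * \<delta> ^ 3"
    using \<delta> mult_left_mono[of 1 "1 + \<delta>" "2 * \<delta> ^ 3"] by (simp_all add: pos_divide_le_eq)
  ultimately show ?thesis unfolding d1 by linarith
qed

lemma error_term_le: "\<delta>\<^sup>2 / real n \<le> 1/4000"
proof -
  have "\<delta>\<^sup>2 / real n \<le> (1/20)\<^sup>2 / 10"
    using \<delta> n by (intro frac_le power_mono) auto
  then show ?thesis by (simp add: power2_eq_square)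
qed

text \<open>The lower bound supplies the diagonal gap of 1/2 for the perturbation lemma, since
  \<open>coef_m2\<close> is tiny.\<close>

lemma coef_d1_bounds: "4/5 \<le> coef_d1 \<delta> n" "coef_d1 \<delta> n \<le> 2"
proof -
  have "\<delta> ^ 3 \<le> (1/20) ^ 3" "\<delta>\<^sup>2 \<le> (1/20)\<^sup>2" using \<delta> by (intro power_mono; simp)+
  then have "\<delta> ^ 3 \<le> 1/8000" "\<delta>\<^sup>2 \<le> 1/400" by (simp_all add: power2_eq_square power3_eq_cube)
  moreover have "2 * \<delta> / real n \<le> 2 * (1/20) / 10" using \<delta> n by (intro frac_le) auto
  moreover have "0 \<le> 2 * \<delta> / real n" "0 \<le> \<delta>\<^sup>2" using \<delta> by simp_all
  ultimately show "4/5 \<le> coef_d1 \<delta> n" "coef_d1 \<delta> n \<le> 2"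
    using coef_d1_asymp error_term_le \<delta> by linarith+
qed

lemma coef_d2_bound: "\<bar>coef_d2 \<delta> n\<bar> \<le> 5"
proof -
  have "coef_d2 \<delta> n = frob_sq \<delta> n / real n - coef_d1 \<delta> n"
    by (simp add: coef_d1_def frob_norm_matC)
  moreover have "0 \<le> frob_sq \<delta> n / real n" "frob_sq \<delta> n / real n \<le> 3"
    using frob_sq_bounds[OF \<delta> n_pos] n by (simp_all add: pos_divide_le_eq)
  ultimately show ?thesis using coef_d1_bounds by linarith
qed

text \<open>The numerators are \<open>n * ?H - ?T\<close> and \<open>?T - ?H\<close> with
  \<open>?H\<close> and \<open>?T\<close> both of order \<open>\<delta>\<^sup>2\<close>. The second
  coefficient is in fact smaller by another factor \<open>1 / n\<close>, but the common bound
  suffices.\<close>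

lemma coef_m_bounds:
  "\<bar>coef_m1 \<delta> n\<bar> \<le> 6 * (\<delta>\<^sup>2 / real n)" "\<bar>coef_m2 \<delta> n\<bar> \<le> 6 * (\<delta>\<^sup>2 / real n)"
proof -
  let ?H = "col_norm_sq \<delta> n" and ?T = "(total_sum \<delta> n)\<^sup>2"
  have H: "0 \<le> ?H" "?H \<le> 2 * \<delta>\<^sup>2" using col_sum_bounds[OF \<delta> n_pos] by auto
  have "?T \<le> (2 * \<delta>)\<^sup>2"
    using col_sum_bounds(1)[OF \<delta> n_pos] \<delta> by (intro iffD1[OF abs_le_square_iff]) auto
  then have T: "0 \<le> ?T" "?T \<le> 4 * \<delta>\<^sup>2" by (simp_all add: power_mult_distrib)
  have n10: "10 * \<delta>\<^sup>2 \<le> real n * \<delta>\<^sup>2" using n by (intro mult_right_mono) auto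
  have nH: "0 \<le> real n * ?H" "real n * ?H \<le> 2 * (real n * \<delta>\<^sup>2)"
    using H mult_left_mono[OF H(2), of "real n"] by simp_all
  have "coef_m1 \<delta> n = (real n * ?H - ?T) / (real n * (real n - 1))"
    using n by (simp add: coef_m1_def coef_m2_def ones_matC_ones euclid_norm_matC_transpose_ones field_simps)
  moreover have "\<bar>real n * ?H - ?T\<bar> \<le> 5 * (real n * \<delta>\<^sup>2)"
    using nH T n10 by linarith
  ultimately show "\<bar>coef_m1 \<delta> n\<bar> \<le> 6 * (\<delta>\<^sup>2 / real n)"
    using n by (simp only:) (intro div_choose_le; simp)
  have "\<bar>?T - ?H\<bar> \<le> 5 * (real n * \<delta>\<^sup>2)"
    using H T n10 by linarith
  then show "\<bar>coef_m2 \<delta> n\<bar> \<le> 6 * (\<delta>\<^sup>2 / real n)"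
    unfolding coef_m2_def ones_matC_ones euclid_norm_matC_transpose_ones
    using n by (intro div_choose_le) auto
qed

text \<open>The constant is 126 = 6 + 4 * 6 * 5: 6 from \<open>coef_d1_asymp\<close>, the rest from
  the perturbation lemma with the bounds on \<open>coef_m1\<close> and \<open>coef_d2\<close>. The
  off-diagonal product is at most 30/4000, below the required 1/16.\<close>

lemma spectral_radius_asymp:
  "\<bar>real_spectral_radius (matM \<delta> n) - (1 - 2 * \<delta> - 2 * \<delta> / real n + 2 * \<delta>\<^sup>2)\<bar>
    \<le> 126 * (\<delta>\<^sup>2 / real n + \<delta> ^ 3)"
proof -
  have "\<bar>coef_m1 \<delta> n * coef_d2 \<delta> n\<bar> \<le> 6 * (\<delta>\<^sup>2 / real n) * 5"
    unfolding abs_mult using coef_m_bounds(1) coef_d2_bound by (intro mult_mono) auto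
  moreover from this have "\<bar>real_spectral_radius (matM \<delta> n) - coef_d1 \<delta> n\<bar>
      \<le> 4 * \<bar>coef_m1 \<delta> n * coef_d2 \<delta> n\<bar>"
    unfolding matM_def using coef_d1_bounds coef_m_bounds(2) error_term_le
    by (intro spectral_radius_2x2_perturbation) linarith+
  moreover have "0 \<le> \<delta> ^ 3" using \<delta> by simp
  ultimately show ?thesis using coef_d1_asymp by (simp only: distrib_left)
qed

end

theorem mainTheorem5:
  shows "\<exists>\<delta>\<^sub>0 K :: real. 0 < \<delta>\<^sub>0 \<and> \<delta>\<^sub>0 \<le> 0.4 \<and> 0 < K \<and>
    (\<forall>(n :: nat) \<delta> :: real. 10 \<le> n \<longrightarrow> 0 < \<delta> \<longrightarrow> \<delta> \<le> \<delta>\<^sub>0 \<longrightarrow>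
      \<bar>real_spectral_radius (matM \<delta> n) - (1 - 2 * \<delta> - 2 * \<delta> / real n + 2 * \<delta>\<^sup>2)\<bar>
        \<le> K * (\<delta>\<^sup>2 / real n + \<delta> ^ 3))"
  by (rule exI[of _ "1/20"], rule exI[of _ 126]) (use spectral_radius_asymp in auto)

end
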